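(* Let $\ell$ and $n$ be nonnegative integers and let $b$ be a complex number such that no zero factor appears in any denominator occurring in the identity below. Then $${}_3F_2\!\left[\begin{matrix}-n,\ \frac{3b}{2}+\ell,\ \frac{1+3b}{2}\\ 3b+\ell,\ b-\frac{n-2}{3}\end{matrix}\,\Big|\,\frac43\right]=\frac{1}{3^n}\,\frac{(3b+n)_n}{(\frac{1-2n}{3}-b)_n}\sum_{i=0}^{\ell}\frac{3b-1+2i}{3b-1}\,\frac{(-\ell)_i(-n)_i(3b-1)_i}{(1)_i(3b+n)_i(3b+\ell)_i}\cdot\frac{(\frac13)_{\frac{n-i}{3}}(\frac23)_{\frac{n-i}{3}}}{(\frac{2-2n-3b}{3})_{\frac{n-i}{3}}(\frac{3-2n-3b}{3})_{\frac{n-i}{3}}}\,\chi(n-i).$$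
   Context: For complex $x$ and an integer $m$, the shifted factorial is $(x)_m=\prod_{k=0}^{m-1}(x+k)$ for $m>0$, $(x)_0=1$, and $(x)_m=(-1)^m/\prod_{k=1}^{-m}(k-x)$ for $m<0$. The hypergeometric series is ${}_3F_2\!\left[\begin{matrix}a_0,a_1,a_2\\ b_1,b_2\end{matrix}\,\Big|\,z\right]=\sum_{k=0}^\infty\frac{(a_0)_k(a_1)_k(a_2)_k}{k!\,(b_1)_k(b_2)_k}z^k$, with parameters such that no zero factors appear in the denominators of the summand; with $a_0=-n$ it is a finite sum over $0\le k\le n$. For an integer $N$, $\chi(N)=1$ if $3\mid N$ and $\chi(N)=0$ otherwise; a summand containing $\chi(n-i)=0$ is understood to be $0$, so only indices $i$ with $(n-i)/3\in\mathbb Z$ contribute. *)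

theory Defs
  imports "HOL-Analysis.Analysis"
begin

text \<open>
  Shifted factorial with integer index; for a natural index it is the library's \<open>pochhammer\<close>.
  For \<open>m < 0\<close> the value is a reciprocal, and since division by zero yields \<open>0\<close>, in both cases
  \<open>shifted_fact x m \<noteq> 0\<close> says exactly that none of the factors in the defining product is zero.
\<close>

definition shifted_fact :: "complex \<Rightarrow> int \<Rightarrow> complex" where
  "shifted_fact x m =
     (if m \<ge> 0 then pochhammer x (nat m)
      else (-1) ^ nat (- m) / (\<Prod>k = 1..nat (- m). (of_nat k - x)))"

definition hyp3F2 ::
    "complex \<Rightarrow> complex \<Rightarrow> complex \<Rightarrow> complex \<Rightarrow> complex \<Rightarrow> complex \<Rightarrow> complex" where
  "hyp3F2 a0 a1 a2 b1 b2 z =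
     (\<Sum>k. pochhammer a0 k * pochhammer a1 k * pochhammer a2 k
            / (fact k * pochhammer b1 k * pochhammer b2 k) * z ^ k)"

definition chi3 :: "int \<Rightarrow> complex" where
  "chi3 N = (if 3 dvd N then 1 else 0)"

end

theory Submission
  imports Defs
begin

text \<open>
  Put \<open>c = 3 b\<close>. A terminating well-poised \<open>5F4\<close> summation expands
  \<open>4^k (c/2 + l)_k ((1 + c)/2)_k / (c + l)_k\<close> as a sum over \<open>i\<close> of multiples of
  \<open>(c + k + i)_(k - i)\<close>. After interchanging the summations and shifting \<open>k = i + m\<close>, the inner
  sum is the case \<open>l = 0\<close> with \<open>(c, n)\<close> replaced by \<open>(c + 2 i, n - i)\<close>. With
  \<open>a = (c + 2 n - 1)/3\<close>, which does not depend on \<open>i\<close>, that case compares the coefficients of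
  \<open>u^N\<close> in \<open>((1 - u)^3 + 3 u (1 - u))^a = (1 - u^3)^a\<close>; this is where \<open>3 dvd N\<close> comes from.
\<close>

section \<open>Coefficients of \<open>(1 - u^3)^a\<close>\<close>

text \<open>With \<open>U = 1 - X\<close>, the coefficient of \<open>X^N\<close> is read off twice:
  from the direct expansion, and from \<open>1 - X^3 = 3 X U + U^3\<close>, where choosing
  \<open>3 X U\<close> exactly \<open>r\<close> times contributes
  \<open>3^r X^r U^(3 a - 2 r)\<close>.\<close>

lemma one_minus_cube_coeff_nat:
  fixes a N :: nat
  shows "(\<Sum>r\<le>N. (- 1) ^ (N - r) * ((3 * of_nat a - 2 * of_nat r) gchoose (N - r)) * 3 ^ r
            * (of_nat a gchoose r))
         = (if 3 dvd N then (- 1) ^ (N div 3) * (of_nat a gchoose (N div 3)) else (0::complex))"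
proof -
  define U :: "complex poly" where "U = [:1, - 1:]"
  define X :: "complex poly" where "X = monom 1 1"
  have X: "X = [:0, 1:]" by (simp add: X_def monom_altdef)
  have cube: "1 - X ^ 3 = 3 * X * U + U ^ 3"
    unfolding U_def X by (simp add: power3_eq_cube one_pCons numeral_poly)
  have coeff_U: "coeff (U ^ j) i = of_nat (j choose i) * (- 1) ^ i" for i j
  proof (cases "i \<le> j")
    case True
    then show ?thesis by (simp add: U_def coeff_linear_poly_power)
  next
    case False
    moreover have "degree (U ^ j) \<le> j" using degree_power_le[of U j] by (simp add: U_def)
    ultimately show ?thesis by (simp add: coeff_eq_0)
  qed
  have "coeff ((1 - X ^ 3) ^ a) N
      = (\<Sum>r\<le>a. coeff (of_nat (a choose r) * (3 * X * U) ^ r * (U ^ 3) ^ (a - r)) N)"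
    unfolding cube binomial_ring by (simp add: coeff_sum)
  also have "\<dots> = (\<Sum>r\<le>a. if r \<le> N then (- 1) ^ (N - r)
      * of_nat ((3 * a - 2 * r) choose (N - r)) * 3 ^ r * of_nat (a choose r) else 0)"
  proof (rule sum.cong[OF refl])
    fix r assume "r \<in> {..a}"
    then have "3 * a - 2 * r = r + 3 * (a - r)" by simp
    then have "U ^ (3 * a - 2 * r) = U ^ r * (U ^ 3) ^ (a - r)"
      by (simp only: power_add power_mult)
    then have "of_nat (a choose r) * (3 * X * U) ^ r * (U ^ 3) ^ (a - r)
        = [:of_nat (a choose r) * 3 ^ r:] * (monom 1 r * U ^ (3 * a - 2 * r))"
      by (simp add: power_mult_distrib X_def monom_power numeral_poly
            of_nat_poly smult_power mult_ac)
    then show "coeff (of_nat (a choose r) * (3 * X * U) ^ r * (U ^ 3) ^ (a - r)) N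
        = (if r \<le> N then (- 1) ^ (N - r)
            * of_nat ((3 * a - 2 * r) choose (N - r)) * 3 ^ r * of_nat (a choose r) else 0)"
      by (simp add: coeff_monom_mult coeff_U)
  qed
  also have "\<dots> = (\<Sum>r\<in>{..a} \<inter> {..N}. (- 1) ^ (N - r)
      * of_nat ((3 * a - 2 * r) choose (N - r)) * 3 ^ r * of_nat (a choose r))"
    by (subst sum.inter_restrict) simp_all
  \<comment> \<open>Passing to all \<open>r \<le> N\<close> adds only terms with
    \<open>r > a\<close>, where \<open>of_nat a gchoose r\<close> vanishes. For
    \<open>r \<le> a\<close> the natural difference \<open>3 * a - 2 * r\<close> is not
    truncated.\<close>
  also have "\<dots> = (\<Sum>r\<le>N. (- 1) ^ (N - r) * ((3 * of_nat a - 2 * of_nat r) gchoose (N - r)) * 3 ^ r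
            * (of_nat a gchoose r))"
    by (rule sum.mono_neutral_cong_left)
      (auto simp: binomial_gbinomial[symmetric] binomial_gbinomial[where n = "3 * a - 2 * _"] of_nat_diff)
  finally have lhs: "coeff ((1 - X ^ 3) ^ a) N = \<dots>" .
  have "(1 - X ^ 3) ^ a = (\<Sum>j\<le>a. monom (of_nat (a choose j) * (- 1) ^ j) (3 * j))"
  proof -
    have "(1 - X ^ 3) ^ a = (monom (- 1) 3 + 1) ^ a"
      by (simp add: X_def monom_power flip: minus_monom)
    also have "\<dots> = (\<Sum>j\<le>a. monom (of_nat (a choose j) * (- 1) ^ j) (3 * j))"
      unfolding binomial_ring by (simp add: monom_power of_nat_poly smult_monom)
    finally show ?thesis .
  qed
  then have "coeff ((1 - X ^ 3) ^ a) N = (\<Sum>j\<le>a. if 3 * j = N then of_nat (a choose j) * (- 1) ^ j else 0)"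
    by (simp add: coeff_sum)
  also have "\<dots> = (if 3 dvd N then (- 1) ^ (N div 3) * (of_nat a gchoose (N div 3)) else 0)"
  proof (cases "3 dvd N")
    case True
    then obtain q where q: "N = 3 * q" by auto
    then have "(3 * j = N) = (j = q)" for j by auto
    then show ?thesis using q by (simp add: binomial_gbinomial[symmetric])
  next
    case False
    then have "3 * j \<noteq> N" for j by auto
    then show ?thesis using False by simp
  qed
  finally show ?thesis using lhs by simp
qed

lemma gbinomial_linear_poly:
  "poly (smult (1 / fact k) (\<Prod>i<k. [:v - of_nat i, u:])) x = ((u * x + v) gchoose k)"
  for x :: complex
  by (simp add: poly_prod gbinomial_prod_rev atLeast0LessThan algebra_simps)

text \<open>For fixed \<open>N\<close> both sides are polynomials in \<open>a\<close>, as a binomial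
  coefficient with affine upper entry is one. Their difference \<open>p\<close> vanishes at every
  natural number, hence identically.\<close>

lemma one_minus_cube_coeff:
  fixes a :: complex and N :: nat
  shows "(\<Sum>r\<le>N. (- 1) ^ (N - r) * ((3 * a - 2 * of_nat r) gchoose (N - r)) * 3 ^ r * (a gchoose r))
         = (if 3 dvd N then (- 1) ^ (N div 3) * (a gchoose (N div 3)) else 0)"
proof -
  define g where "g = (\<lambda>k v u. smult (1 / fact k) (\<Prod>i<k. [:v - of_nat i, u:]) :: complex poly)"
  have g: "poly (g k v u) x = ((u * x + v) gchoose k)" for k v u x
    unfolding g_def by (rule gbinomial_linear_poly)
  define p where "p = (\<Sum>r\<le>N. smult ((- 1) ^ (N - r) * 3 ^ r) (g (N - r) (- 2 * of_nat r) 3 * g r 0 1))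
      - (if 3 dvd N then smult ((- 1) ^ (N div 3)) (g (N div 3) 0 1) else 0)"
  have p: "poly p x = (\<Sum>r\<le>N. (- 1) ^ (N - r) * ((3 * x - 2 * of_nat r) gchoose (N - r)) * 3 ^ r * (x gchoose r))
         - (if 3 dvd N then (- 1) ^ (N div 3) * (x gchoose (N div 3)) else 0)" for x
    by (simp add: p_def g poly_sum algebra_simps)
  have "range of_nat \<subseteq> {x. poly p x = 0}"
    by (auto simp: p one_minus_cube_coeff_nat)
  moreover have "infinite (range (of_nat :: nat \<Rightarrow> complex))"
    by (simp add: finite_image_iff inj_on_def)
  ultimately have "p = 0"
    using poly_roots_finite finite_subset by blast
  then show ?thesis using p[of a] by simp
qed

section \<open>The terminating well-poised summation\<close>

text \<open>
  \<open>well_poised_weight c i\<close> is the well-poised factor \<open>(c - 1 + 2 i) (c - 1)_i / (c - 1)\<close> with the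
  division carried out, so that the expansion below is a polynomial identity in \<open>c\<close> and \<open>z\<close>. The
  theorem needs it also where \<open>(c)_k\<close> or \<open>(c/2)_k\<close>, the denominators of the \<open>5F4\<close> series, vanish.
\<close>

definition well_poised_weight :: "complex \<Rightarrow> nat \<Rightarrow> complex" where
  "well_poised_weight c i = (case i of 0 \<Rightarrow> 1 | Suc j \<Rightarrow> (c + 1 + 2 * of_nat j) * pochhammer c j)"

text \<open>Where no denominator vanishes, this is \<open>(c + k)_k (c + z)_k\<close> times the
  \<open>i\<close>-th term of the very-well-poised series with leading parameter
  \<open>c - 1\<close> and numerator parameters \<open>-z\<close> and \<open>-k\<close>; the
  remaining parameter \<open>c/2\<close> of the \<open>5F4\<close> cancels against its partner. The
  complex \<open>z\<close> takes the place of \<open>l\<close>.\<close>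

definition well_poised_term :: "complex \<Rightarrow> complex \<Rightarrow> nat \<Rightarrow> nat \<Rightarrow> complex" where
  "well_poised_term c z k i = well_poised_weight c i * (z gchoose i) * (fact k / fact (k - i))
     * pochhammer (c + of_nat (k + i)) (k - i) * pochhammer (c + z + of_nat i) (k - i)"

lemma Suc_times_gbinomial_Suc: "of_nat (Suc m) * (z gchoose Suc m) = (z - of_nat m) * (z gchoose m)"
  for z :: complex
  by (simp add: gbinomial_absorption' gbinomial_mult_1 algebra_simps)

text \<open>The right-hand side is the Wilf--Zeilberger certificate of the recurrence in \<open>k\<close>.\<close>

lemma well_poised_term_partial_sum:
  assumes "m < k"
  shows "(\<Sum>i\<le>m. well_poised_term c z (Suc k) i
             - (c + 2 * z + 2 * of_nat k) * (c + 1 + 2 * of_nat k) * well_poised_term c z k i)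
         = - (c + 2 * of_nat k + 1) * (c + 2 * of_nat m) * pochhammer c m
             * (z - of_nat m) * (z gchoose m) * (fact k / fact (k - m))
             * pochhammer (c + of_nat (k + m + 1)) (k - m - 1) * pochhammer (c + z + of_nat m) (k - m)"
  using assms
proof (induction m)
  case 0
  then obtain p where k: "k = Suc p" by (cases k) auto
  define V W K where "V = pochhammer (c + of_nat k + 1) p" and "W = pochhammer (c + z) k"
    and "K = (of_nat k :: complex)"
  have T1: "well_poised_term c z (Suc k) 0 = V * (c + 2 * K) * (c + 2 * K + 1) * (W * (c + z + K))"
  proof -
    have "pochhammer (c + of_nat (Suc k)) (Suc k) = V * (c + 2 * K) * (c + 2 * K + 1)"
      unfolding V_def K_def k by (simp add: pochhammer_Suc algebra_simps)
    moreover have "pochhammer (c + z) (Suc k) = W * (c + z + K)"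
      by (simp add: W_def K_def pochhammer_Suc)
    ultimately show ?thesis by (simp add: well_poised_term_def well_poised_weight_def del: of_nat_Suc)
  qed
  have T2: "well_poised_term c z k 0 = (c + K) * V * W"
  proof -
    have "pochhammer (c + of_nat k) k = (c + K) * V"
      unfolding V_def K_def k by (simp add: pochhammer_rec)
    then show ?thesis by (simp add: well_poised_term_def well_poised_weight_def W_def)
  qed
  have "well_poised_term c z (Suc k) 0 - (c + 2 * z + 2 * K) * (c + 1 + 2 * K) * well_poised_term c z k 0
      = - (c + 2 * K + 1) * c * z * V * W"
    unfolding T1 T2 by algebra
  moreover have "k - 1 = p" using k by simp
  ultimately show ?case by (simp add: V_def W_def K_def add_ac)
next
  case (Suc m)
  \<comment> \<open>Since \<open>Suc m < k\<close>, this difference is not truncated. Each shifted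
    factorial whose length depends on \<open>p\<close> is reduced to \<open>V\<close> or
    \<open>W\<close> times linear factors, which leaves a polynomial identity.\<close>
  define p where "p = k - m - 2"
  have k: "k = m + p + 2" using Suc.prems by (simp add: p_def)
  have kp: "k - m = Suc (Suc p)" "k - Suc m = Suc p" "Suc k - Suc m = Suc (Suc p)"
      "k - m - 1 = Suc p" "k - Suc m - 1 = p"
    using k by auto
  define V where "V = pochhammer (c + of_nat (k + m + 2)) p"
  define W where "W = pochhammer (c + z + of_nat (Suc m)) (Suc p)"
  define M K where "M = (of_nat m :: complex)" and "K = (of_nat k :: complex)"
  have p_eq: "of_nat p = K - M - 2" by (simp add: M_def K_def k)
  have c0: "(z - M) * (z gchoose m) = (M + 1) * (z gchoose Suc m)"
    using Suc_times_gbinomial_Suc[of m z] by (simp add: M_def algebra_simps)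
  have V1: "pochhammer (c + of_nat (k + m + 1)) (Suc p) = (c + K + M + 1) * V"
    by (simp add: V_def pochhammer_rec K_def M_def algebra_simps)
  have V2: "pochhammer (c + of_nat (Suc k + Suc m)) (Suc (Suc p)) = V * (c + 2 * K) * (c + 2 * K + 1)"
    by (simp add: V_def pochhammer_Suc p_eq) (simp add: K_def M_def algebra_simps)
  have W1: "pochhammer (c + z + of_nat m) (Suc (Suc p)) = (c + z + M) * W"
    unfolding W_def pochhammer_rec[of "c + z + of_nat m" "Suc p"] by (simp add: M_def add_ac)
  have W2: "pochhammer (c + z + of_nat (Suc m)) (Suc (Suc p)) = W * (c + z + K)"
    unfolding W_def pochhammer_Suc[of _ "Suc p"] by (simp add: p_eq) (simp add: M_def K_def)
  have f1: "fact (Suc (Suc p)) = (K - M) * (fact (Suc p) :: complex)"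
    by (simp only: fact_Suc[of "Suc p"]) (simp add: p_eq)
  have "K - M = of_nat (Suc (Suc p))" by (simp add: M_def K_def k)
  then have KM: "K - M \<noteq> 0" by (simp only: of_nat_eq_0_iff nat.distinct not_False_eq_True)
  have f2: "fact (Suc k) = (K + 1) * (fact k :: complex)" by (simp add: K_def)
  define P B F where "P = pochhammer c m" and "B = (z gchoose Suc m)"
    and "F = (fact k :: complex) / fact (Suc p)"
  have ff: "fact k / fact (Suc (Suc p)) = F / (K - M)" 
      "fact (Suc k) / fact (Suc (Suc p)) = (K + 1) * F / (K - M)"
    unfolding f1 f2 F_def by simp_all
  have T1: "well_poised_term c z (Suc k) (Suc m) = (c + 1 + 2 * M) * P * B * ((K + 1) * F / (K - M))
      * (V * (c + 2 * K) * (c + 2 * K + 1)) * (W * (c + z + K))"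
    unfolding well_poised_term_def kp V2 W2 ff B_def by (simp add: well_poised_weight_def M_def P_def)
  have T2: "well_poised_term c z k (Suc m) = (c + 1 + 2 * M) * P * B * F * ((c + K + M + 1) * V) * W"
    unfolding well_poised_term_def kp using V1 by (simp add: well_poised_weight_def M_def P_def W_def B_def F_def)
  have "(\<Sum>i\<le>Suc m. well_poised_term c z (Suc k) i
             - (c + 2 * z + 2 * K) * (c + 1 + 2 * K) * well_poised_term c z k i)
     = - (c + 2 * K + 1) * (c + 2 * M) * P * ((z - M) * (z gchoose m)) * (F / (K - M))
         * ((c + K + M + 1) * V) * ((c + z + M) * W)
       + (well_poised_term c z (Suc k) (Suc m) - (c + 2 * z + 2 * K) * (c + 1 + 2 * K) * well_poised_term c z k (Suc m))"
    using Suc.IH[OF Suc_lessD[OF Suc.prems], unfolded kp(4), unfolded kp(1) V1 W1 ff]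
    by (simp add: M_def K_def P_def mult.assoc)
  also have "\<dots> = - (c + 2 * K + 1) * (c + 2 * (M + 1)) * (P * (c + M)) * (z - (M + 1)) * B * F * V * W"
  proof -
    \<comment> \<open>Writing \<open>F = e * (K - M)\<close> removes the last division, so that
      \<open>algebra\<close> applies.\<close>
    define e where "e = F / (K - M)"
    have e: "F = e * (K - M)" "(K + 1) * F / (K - M) = (K + 1) * e"
      using KM by (simp_all add: e_def)
    show ?thesis
      unfolding c0 T1 T2 B_def[symmetric]
      unfolding e(2) e_def[symmetric]
      unfolding e(1)
      by algebra
  qed
  also have "\<dots> = - (c + 2 * of_nat k + 1) * (c + 2 * of_nat (Suc m)) * pochhammer c (Suc m)
             * (z - of_nat (Suc m)) * (z gchoose Suc m) * (fact k / fact (k - Suc m))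
             * pochhammer (c + of_nat (k + Suc m + 1)) (k - Suc m - 1) * pochhammer (c + z + of_nat (Suc m)) (k - Suc m)"
    unfolding kp P_def B_def F_def V_def W_def M_def K_def by (simp add: pochhammer_Suc add_ac)
  finally show ?case by (simp only: K_def)
qed


text \<open>Both sides are \<open>1\<close> at \<open>k = 0\<close> and gain the factor \<open>(c +
  2 z + 2 k) (c + 1 + 2 k) = 4 (c/2 + z + k) ((1 + c)/2 + k)\<close> from \<open>k\<close> to
  \<open>k + 1\<close>; for the left side this follows from the certificate.\<close>

lemma well_poised_sum:
  "(\<Sum>i\<le>k. well_poised_term c z k i) = 4 ^ k * pochhammer (c / 2 + z) k * pochhammer ((1 + c) / 2) k"
proof (induction k)
  case 0
  show ?case by (simp add: well_poised_term_def well_poised_weight_def)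
next
  case (Suc k)
  define R where "R = (c + 2 * z + 2 * of_nat k) * (c + 1 + 2 * of_nat k)"
  have Tkk: "well_poised_term c z k k = well_poised_weight c k * (z gchoose k) * fact k"
    by (simp add: well_poised_term_def)
  have TSk: "well_poised_term c z (Suc k) k = well_poised_weight c k * (z gchoose k) * fact (Suc k)
      * (c + 2 * of_nat k + 1) * (c + z + of_nat k)"
    by (simp add: well_poised_term_def algebra_simps)
  have g: "of_nat (Suc k) * (z gchoose Suc k) = (z - of_nat k) * (z gchoose k)"
    by (rule Suc_times_gbinomial_Suc)
  have "well_poised_term c z (Suc k) (Suc k)
      = (c + 2 * of_nat k + 1) * pochhammer c k * fact k * (of_nat (Suc k) * (z gchoose Suc k))"
    by (simp add: well_poised_term_def well_poised_weight_def algebra_simps)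
  then have TSS: "well_poised_term c z (Suc k) (Suc k)
      = (c + 2 * of_nat k + 1) * pochhammer c k * fact k * (z - of_nat k) * (z gchoose k)"
    unfolding g by (simp add: mult_ac)
  \<comment> \<open>The certificate covers only \<open>i < k\<close>, so the term
    \<open>i = k\<close> is added by hand. The total is cancelled by the term
    \<open>i = Suc k\<close>, which occurs only in the sum for \<open>Suc k\<close>.\<close>
  have "(\<Sum>i\<le>k. well_poised_term c z (Suc k) i - R * well_poised_term c z k i) = - well_poised_term c z (Suc k) (Suc k)"
  proof (cases k)
    case 0
    then show ?thesis using TSk Tkk TSS by (simp add: R_def well_poised_weight_def algebra_simps)
  next
    case (Suc m)
    have "(\<Sum>i\<le>k. well_poised_term c z (Suc k) i - R * well_poised_term c z k i)
        = (\<Sum>i\<le>m. well_poised_term c z (Suc k) i - R * well_poised_term c z k i)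
          + (well_poised_term c z (Suc k) k - R * well_poised_term c z k k)"
      by (simp add: Suc)
    also have "(\<Sum>i\<le>m. well_poised_term c z (Suc k) i - R * well_poised_term c z k i)
        = - (c + 2 * of_nat k + 1) * (c + 2 * of_nat m) * pochhammer c m * fact k
            * ((z - of_nat m) * (z gchoose m)) * (c + z + of_nat m)"
      unfolding R_def using well_poised_term_partial_sum[of m k c z] Suc by (simp add: mult_ac)
    also have "(z - of_nat m) * (z gchoose m) = of_nat k * (z gchoose k)"
      using Suc_times_gbinomial_Suc[of m z] Suc by simp
    finally have *: "(\<Sum>i\<le>k. well_poised_term c z (Suc k) i - R * well_poised_term c z k i)
        = - (c + 2 * of_nat k + 1) * (c + 2 * of_nat m) * pochhammer c m * fact k
            * (of_nat k * (z gchoose k)) * (c + z + of_nat m)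
          + (well_poised_term c z (Suc k) k - R * well_poised_term c z k k)" .
    define M P B F where "M = (of_nat m :: complex)" and "P = pochhammer c m" and "B = (z gchoose k)"
      and "F = (fact k :: complex)"
    have K: "of_nat k = M + 1" using Suc by (simp add: M_def)
    have w: "well_poised_weight c k = (c + 1 + 2 * M) * P" using Suc by (simp add: well_poised_weight_def M_def P_def)
    have pk: "pochhammer c k = P * (c + M)" using Suc by (simp add: pochhammer_Suc P_def M_def)
    have fk: "fact (Suc k) = (M + 2) * F" by (simp add: F_def K)
    show ?thesis
      unfolding *
      unfolding TSk Tkk TSS R_def w pk fk K
      unfolding M_def[symmetric] P_def[symmetric] B_def[symmetric] F_def[symmetric]
      by algebra
  qed
  then have "(\<Sum>i\<le>Suc k. well_poised_term c z (Suc k) i) = R * (\<Sum>i\<le>k. well_poised_term c z k i)"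
    by (simp add: sum_subtractf sum_distrib_left algebra_simps)
  also have "\<dots> = 4 ^ Suc k * pochhammer (c / 2 + z) (Suc k) * pochhammer ((1 + c) / 2) (Suc k)"
    unfolding Suc.IH R_def pochhammer_Suc by (simp add: field_simps)
  finally show ?case .
qed

section \<open>The case \<open>l = 0\<close>\<close>

lemma pochhammer_minus_of_nat_add:
  "pochhammer (- of_nat (m + r)) m = (- 1) ^ m * fact (m + r) / (fact r :: complex)"
proof -
  have "fact (r + m) = (fact r :: complex) * pochhammer (1 + of_nat r) m"
    unfolding pochhammer_fact by (rule pochhammer_product')
  then show ?thesis using pochhammer_minus[of "of_nat (m + r) :: complex" m] by (simp add: add_ac)
qed

text \<open>This is the case \<open>l = 0\<close> multiplied by \<open>(\<beta>)_N\<close>, since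
  \<open>4^m (c/2)_m ((1 + c)/2)_m = (c)_m (c + m)_m\<close>. Reversed by \<open>m = N - r\<close>,
  it is \<open>N!/3^N\<close> times the sum in \<open>one_minus_cube_coeff\<close> at
  \<open>a = (c + 2 N - 1)/3\<close>, because then \<open>3 a - 2 r = c + 2 m - 1\<close> and
  \<open>a - r + 1 = \<beta> + m\<close>.\<close>

lemma sum_pochhammer_one_minus_cube:
  fixes c :: complex and N :: nat
  defines "\<beta> \<equiv> (c - of_nat N + 2) / 3"
  shows "(\<Sum>m\<le>N. pochhammer (- of_nat N) m * pochhammer (c + of_nat m) m / (fact m * 3 ^ m)
             * pochhammer (\<beta> + of_nat m) (N - m))
       = (if 3 dvd N then fact N / 3 ^ N * (- 1) ^ (N div 3) * (((c + 2 * of_nat N - 1) / 3) gchoose (N div 3))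
          else 0)"
proof -
  define \<alpha> where "\<alpha> = (c + 2 * of_nat N - 1) / 3"
  have "(\<Sum>m\<le>N. pochhammer (- of_nat N) m * pochhammer (c + of_nat m) m / (fact m * 3 ^ m)
             * pochhammer (\<beta> + of_nat m) (N - m))
     = (\<Sum>r\<le>N. pochhammer (- of_nat N) (N - r) * pochhammer (c + of_nat (N - r)) (N - r)
            / (fact (N - r) * 3 ^ (N - r)) * pochhammer (\<beta> + of_nat (N - r)) r)"
    by (subst sum.nat_diff_reindex[symmetric, of _ "Suc N", unfolded lessThan_Suc_atMost]) auto
  also have "\<dots> = (\<Sum>r\<le>N. fact N / 3 ^ N *
      ((- 1) ^ (N - r) * ((3 * \<alpha> - 2 * of_nat r) gchoose (N - r)) * 3 ^ r * (\<alpha> gchoose r)))"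
  proof (rule sum.cong[OF refl])
    fix r assume "r \<in> {..N}"
    then obtain m where m: "N = m + r" by (metis atMost_iff le_add_diff_inverse2)
    have 1: "pochhammer (- of_nat N) m = (- 1) ^ m * fact N / (fact r :: complex)"
      unfolding m by (rule pochhammer_minus_of_nat_add)
    have 2: "((3 * \<alpha> - 2 * of_nat r) gchoose m) = pochhammer (c + of_nat m) m / fact m"
    proof -
      have "3 * \<alpha> - 2 * of_nat r - of_nat m + 1 = c + of_nat m"
        by (simp add: \<alpha>_def m field_simps)
      then show ?thesis by (simp only: gbinomial_pochhammer')
    qed
    have 3: "(\<alpha> gchoose r) = pochhammer (\<beta> + of_nat m) r / fact r"
      unfolding gbinomial_pochhammer' by (simp add: \<alpha>_def \<beta>_def m field_simps)
    have "N - r = m" using m by simp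
    show "pochhammer (- of_nat N) (N - r) * pochhammer (c + of_nat (N - r)) (N - r)
            / (fact (N - r) * 3 ^ (N - r)) * pochhammer (\<beta> + of_nat (N - r)) r
      = fact N / 3 ^ N *
      ((- 1) ^ (N - r) * ((3 * \<alpha> - 2 * of_nat r) gchoose (N - r)) * 3 ^ r * (\<alpha> gchoose r))"
      unfolding \<open>N - r = m\<close> 1 2 3 by (simp add: m power_add mult_ac)
  qed
  also have "\<dots> = (if 3 dvd N then fact N / 3 ^ N * (- 1) ^ (N div 3) * (\<alpha> gchoose (N div 3)) else 0)"
    unfolding sum_distrib_left[symmetric] one_minus_cube_coeff by simp
  finally show ?thesis unfolding \<alpha>_def .
qed


section \<open>Shifted factorials in thirds\<close>

text \<open>Gauss's multiplication formula, by splitting off three factors at a time. At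
  \<open>x = 1\<close> it extracts \<open>(1/3)_q (2/3)_q\<close> from
  \<open>(3 q)!\<close>.\<close>

lemma pochhammer_triple:
  "pochhammer x (3 * q) = 27 ^ q * pochhammer (x / 3) q * pochhammer ((x + 1) / 3) q * pochhammer ((x + 2) / 3) q"
  for x :: complex
proof (induction q)
  case (Suc q)
  have "3 * Suc q = Suc (Suc (Suc (3 * q)))" by simp
  then have "pochhammer x (3 * Suc q)
      = pochhammer x (3 * q) * (x + 3 * of_nat q) * (x + 3 * of_nat q + 1) * (x + 3 * of_nat q + 2)"
    by (simp only: pochhammer_Suc) (simp add: algebra_simps)
  also have "\<dots> = 27 ^ Suc q * pochhammer (x / 3) (Suc q) * pochhammer ((x + 1) / 3) (Suc q)
      * pochhammer ((x + 2) / 3) (Suc q)"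
    unfolding Suc.IH pochhammer_Suc by (simp add: field_simps)
  finally show ?case .
qed simp

lemma shifted_fact_of_nat [simp]: "shifted_fact x (int q) = pochhammer x q"
  by (simp add: shifted_fact_def)

lemma well_poised_weight_eq:
  assumes "c \<noteq> 1"
  shows "well_poised_weight c i = (c - 1 + 2 * of_nat i) / (c - 1) * pochhammer (c - 1) i"
  using assms by (cases i) (simp_all add: well_poised_weight_def pochhammer_rec add_ac)

text \<open>With \<open>x = c + n + i\<close>, the quotient \<open>(c + n)_n / (c + n)_i\<close> is
  \<open>(x)_(3 q)\<close>, which splits into thirds. The blocks at \<open>x/3\<close> and
  \<open>(x + 1)/3\<close> cancel the two denominators after reversal of their factors; the block at
  \<open>(x + 2)/3\<close> is \<open>q!\<close> times the binomial coefficient.\<close>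

lemma fact_gbinomial_eq_pochhammer_quotient:
  fixes c :: complex and n i q :: nat
  assumes n: "n = i + 3 * q"
    and nz: "pochhammer (c + of_nat n) i \<noteq> 0"
      "pochhammer ((2 - 2 * of_nat n - c) / 3) q \<noteq> 0" "pochhammer ((3 - 2 * of_nat n - c) / 3) q \<noteq> 0"
  shows "fact (3 * q) * (- 1) ^ q * (((c + 2 * of_nat n - 1) / 3) gchoose q)
       = (- 1) ^ q * pochhammer (c + of_nat n) n / pochhammer (c + of_nat n) i
          * (pochhammer (1 / 3) q * pochhammer (2 / 3) q
             / (pochhammer ((2 - 2 * of_nat n - c) / 3) q * pochhammer ((3 - 2 * of_nat n - c) / 3) q))"
proof -
  define x where "x = c + of_nat n + of_nat i"
  have "pochhammer (c + of_nat n) n = pochhammer (c + of_nat n) i * pochhammer x (3 * q)"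
    unfolding x_def by (subst (2) n) (rule pochhammer_product')
  then have 1: "pochhammer (c + of_nat n) n / pochhammer (c + of_nat n) i = pochhammer x (3 * q)"
    using nz by simp
  have 2: "pochhammer ((2 - 2 * of_nat n - c) / 3) q = (- 1) ^ q * pochhammer ((x + 1) / 3) q"
  proof -
    have "- ((c + 2 * of_nat n - 2) / 3) = (2 - 2 * of_nat n - c) / 3"
      by (simp add: field_simps)
    moreover have "(c + 2 * of_nat n - 2) / 3 - of_nat q + 1 = (x + 1) / 3"
      by (simp add: x_def n field_simps)
    ultimately show ?thesis
      using pochhammer_minus[of "(c + 2 * of_nat n - 2) / 3" q] by (simp only:)
  qed
  have 3: "pochhammer ((3 - 2 * of_nat n - c) / 3) q = (- 1) ^ q * pochhammer (x / 3) q"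
  proof -
    have "- ((c + 2 * of_nat n - 3) / 3) = (3 - 2 * of_nat n - c) / 3"
      by (simp add: field_simps)
    moreover have "(c + 2 * of_nat n - 3) / 3 - of_nat q + 1 = (x) / 3"
      by (simp add: x_def n field_simps)
    ultimately show ?thesis
      using pochhammer_minus[of "(c + 2 * of_nat n - 3) / 3" q] by (simp only:)
  qed
  have 4: "(((c + 2 * of_nat n - 1) / 3) gchoose q) = pochhammer ((x + 2) / 3) q / fact q"
    unfolding gbinomial_pochhammer' by (simp add: x_def n field_simps)
  have 5: "fact (3 * q) = (27 ^ q * pochhammer (1 / 3) q * pochhammer (2 / 3) q * fact q :: complex)"
    using pochhammer_triple[of 1 q] by (simp add: pochhammer_fact)
  have nz': "pochhammer ((x + 1) / 3) q \<noteq> 0" "pochhammer (x / 3) q \<noteq> 0"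
    using nz 2 3 by auto
  have "(- 1) ^ q * ((- 1) ^ q :: complex) = 1" by (simp flip: power_mult_distrib)
  then show ?thesis
    unfolding 2 3 4 5 times_divide_eq_right[symmetric] 1 pochhammer_triple[of x] using nz'
    by (simp add: field_simps)
qed

section \<open>Interchange of the summations and assembly\<close>

text \<open>The factor \<open>(c + l + i)_m\<close> of the expansion cancels the tail of
  \<open>(c + l)_(i + m)\<close>, and \<open>(i + m)!\<close> cancels too. What remains is a factor
  free of \<open>m\<close> times a summand of the case \<open>l = 0\<close> at
  \<open>(c + 2 i, n - i)\<close>. Later \<open>B\<close> is \<open>(\<beta>)_k 3^k\<close>.\<close>

lemma well_poised_term_shift:
  fixes c B :: complex and l n i m :: nat
  assumes "i + m \<le> n" and nz: "pochhammer (c + of_nat l) n \<noteq> 0"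
  shows "pochhammer (- of_nat n) (i + m) / (fact (i + m) * pochhammer (c + of_nat l) (i + m) * B)
      * well_poised_term c (of_nat l) (i + m) i
    = well_poised_weight c i * (of_nat l gchoose i) * pochhammer (- of_nat n) i / pochhammer (c + of_nat l) i
      * (pochhammer (- of_nat (n - i)) m * pochhammer (c + 2 * of_nat i + of_nat m) m / (fact m * B))"
proof -
  have a: "pochhammer (c + of_nat l) (i + m) = pochhammer (c + of_nat l) i * pochhammer (c + of_nat l + of_nat i) m"
    by (rule pochhammer_product')
  have b: "pochhammer (- of_nat n) (i + m) = pochhammer (- of_nat n) i * pochhammer (- of_nat (n - i) :: complex) m"
    using assms(1) by (simp add: pochhammer_product' of_nat_diff)
  have "pochhammer (c + of_nat l) (i + m) \<noteq> 0"
    using pochhammer_neq_0_mono[OF nz assms(1)] .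
  then show ?thesis
    unfolding well_poised_term_def a b by (simp add: field_simps)
qed

theorem theorem8:
  fixes l n :: nat and b :: complex
  assumes hyp_denom:
    "\<And>k. k \<le> n \<Longrightarrow>
       pochhammer (3 * b + of_nat l) k \<noteq> 0 \<and>
       pochhammer (b - (of_nat n - 2) / 3) k \<noteq> 0"
  and prefactor_denom:
    "pochhammer ((1 - 2 * of_nat n) / 3 - b) n \<noteq> 0"
  and summand_denom:
    "\<And>i. i \<le> l \<Longrightarrow> 3 dvd (int n - int i) \<Longrightarrow>
       3 * b - 1 \<noteq> 0 \<and>
       pochhammer (3 * b + of_nat n) i \<noteq> 0 \<and>
       pochhammer (3 * b + of_nat l) i \<noteq> 0 \<and>
       shifted_fact ((2 - 2 * of_nat n - 3 * b) / 3) ((int n - int i) div 3) \<noteq> 0 \<and>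
       shifted_fact ((3 - 2 * of_nat n - 3 * b) / 3) ((int n - int i) div 3) \<noteq> 0"
  shows
    "hyp3F2 (- of_nat n) (3 * b / 2 + of_nat l) ((1 + 3 * b) / 2)
            (3 * b + of_nat l) (b - (of_nat n - 2) / 3) (4 / 3) =
     1 / 3 ^ n * (pochhammer (3 * b + of_nat n) n / pochhammer ((1 - 2 * of_nat n) / 3 - b) n) *
     (\<Sum>i = 0..l.
        (3 * b - 1 + 2 * of_nat i) / (3 * b - 1) *
        (pochhammer (- of_nat l) i * pochhammer (- of_nat n) i * pochhammer (3 * b - 1) i
          / (pochhammer 1 i * pochhammer (3 * b + of_nat n) i * pochhammer (3 * b + of_nat l) i)) *
        (shifted_fact (1 / 3) ((int n - int i) div 3) * shifted_fact (2 / 3) ((int n - int i) div 3)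
          / (shifted_fact ((2 - 2 * of_nat n - 3 * b) / 3) ((int n - int i) div 3)
             * shifted_fact ((3 - 2 * of_nat n - 3 * b) / 3) ((int n - int i) div 3))) *
        chi3 (int n - int i))"
proof -
  define c where "c = 3 * b"
  define \<beta> where "\<beta> = (c - of_nat n + 2) / 3"
  define \<alpha> where "\<alpha> = (c + 2 * of_nat n - 1) / 3"
  define L where "L = c + of_nat l"
  have b: "b = c / 3" by (simp add: c_def)
  have \<beta>: "b - (of_nat n - 2) / 3 = \<beta>" by (simp add: b \<beta>_def diff_divide_distrib add_divide_distrib)
  have Lnz: "pochhammer L k \<noteq> 0" and \<beta>nz: "pochhammer \<beta> k \<noteq> 0" if "k \<le> n" for k
    using hyp_denom[OF that] by (simp_all only: \<beta> L_def c_def not_False_eq_True)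
  define W where "W = (\<lambda>i. well_poised_weight c i * (of_nat l gchoose i) * pochhammer (- of_nat n) i / pochhammer L i)"
  define f where "f = (\<lambda>i m. W i * (pochhammer (- of_nat (n - i)) m * pochhammer (c + 2 * of_nat i + of_nat m) m
      / (fact m * (pochhammer \<beta> (i + m) * 3 ^ (i + m)))))"
  have "hyp3F2 (- of_nat n) (3 * b / 2 + of_nat l) ((1 + 3 * b) / 2)
            (3 * b + of_nat l) (b - (of_nat n - 2) / 3) (4 / 3)
     = (\<Sum>k\<le>n. pochhammer (- of_nat n) k * pochhammer (c / 2 + of_nat l) k * pochhammer ((1 + c) / 2) k
            / (fact k * pochhammer L k * pochhammer \<beta> k) * (4 / 3) ^ k)"
    unfolding hyp3F2_def \<beta> c_def[symmetric] L_def[symmetric]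
    \<comment> \<open>For \<open>k > n\<close> the numerator factor \<open>(-n)_k\<close> is zero,
      so those terms are \<open>0\<close> whatever their denominators are.\<close>
    by (rule suminf_finite) (auto simp: pochhammer_of_nat_eq_0_lemma)
  also have "\<dots> = (\<Sum>k\<le>n. \<Sum>i\<le>k. f i (k - i))"
  proof (rule sum.cong[OF refl])
    fix k assume "k \<in> {..n}"
    then have k: "k \<le> n" by simp
    have "pochhammer (- of_nat n) k * pochhammer (c / 2 + of_nat l) k * pochhammer ((1 + c) / 2) k
            / (fact k * pochhammer L k * pochhammer \<beta> k) * (4 / 3) ^ k
      = pochhammer (- of_nat n) k / (fact k * pochhammer L k * (pochhammer \<beta> k * 3 ^ k))
        * (\<Sum>i\<le>k. well_poised_term c (of_nat l) k i)"
      unfolding well_poised_sum by (simp add: power_divide mult_ac)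
    also have "\<dots> = (\<Sum>i\<le>k. f i (k - i))"
      unfolding sum_distrib_left
    proof (rule sum.cong[OF refl])
      fix i assume "i \<in> {..k}"
      then have ik: "i + (k - i) = k" by simp
      show "pochhammer (- of_nat n) k / (fact k * pochhammer L k * (pochhammer \<beta> k * 3 ^ k))
          * well_poised_term c (of_nat l) k i = f i (k - i)"
        using well_poised_term_shift[of i "k - i" n c l "pochhammer \<beta> k * 3 ^ k"] Lnz[of n] k
        unfolding f_def W_def ik L_def by simp
    qed
    finally show "pochhammer (- of_nat n) k * pochhammer (c / 2 + of_nat l) k * pochhammer ((1 + c) / 2) k
            / (fact k * pochhammer L k * pochhammer \<beta> k) * (4 / 3) ^ k = (\<Sum>i\<le>k. f i (k - i))" .
  qed
  also have "\<dots> = (\<Sum>(i, m)\<in>{(i, m). i + m \<le> n}. f i m)"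
    by (rule sum.triangle_reindex_eq[symmetric])
  also have "{(i, m). i + m \<le> n} = (SIGMA i:{..n}. {..n - i})" by auto
  also have "(\<Sum>(i, m)\<in>(SIGMA i:{..n}. {..n - i}). f i m) = (\<Sum>i\<le>n. \<Sum>m\<le>n - i. f i m)"
    by (rule sum.Sigma[symmetric]) auto
  also have "\<dots> = (\<Sum>i\<le>n. if 3 dvd (n - i)
      then W i * fact (n - i) * (- 1) ^ ((n - i) div 3) * (\<alpha> gchoose ((n - i) div 3)) / (3 ^ n * pochhammer \<beta> n)
      else 0)"
  proof (rule sum.cong[OF refl])
    fix i assume "i \<in> {..n}"
    then have i: "i \<le> n" by simp
    define c' where "c' = c + 2 * of_nat i"
    \<comment> \<open>Replacing \<open>(c, n)\<close> by \<open>(c + 2 i, n - i)\<close> fixes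
      \<open>\<alpha>\<close> and moves \<open>\<beta>\<close> to
      \<open>\<beta> + i\<close>.\<close>
    have \<beta>': "(c' - of_nat (n - i) + 2) / 3 = \<beta> + of_nat i"
      and \<alpha>': "(c' + 2 * of_nat (n - i) - 1) / 3 = \<alpha>"
      using i by (simp_all add: c'_def \<beta>_def \<alpha>_def of_nat_diff field_simps)
    have "(\<Sum>m\<le>n - i. f i m) = W i / (3 ^ i * pochhammer \<beta> n) *
        (\<Sum>m\<le>n - i. pochhammer (- of_nat (n - i)) m * pochhammer (c' + of_nat m) m / (fact m * 3 ^ m)
             * pochhammer (\<beta> + of_nat i + of_nat m) (n - i - m))"
      unfolding sum_distrib_left
    proof (rule sum.cong[OF refl])
      fix m assume "m \<in> {..n - i}"
      then have m: "i + m \<le> n" using i by simp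
      \<comment> \<open>The common denominator \<open>(\<beta>)_n\<close> supplies the complementary
        factor present in the cleared form of the case \<open>l = 0\<close>.\<close>
      have p: "pochhammer \<beta> n = pochhammer \<beta> (i + m) * pochhammer (\<beta> + of_nat i + of_nat m) (n - i - m)"
        using pochhammer_product[OF m, of \<beta>] by (simp add: add_ac)
      have "pochhammer \<beta> n \<noteq> 0" by (rule \<beta>nz) simp
      then show "f i m = W i / (3 ^ i * pochhammer \<beta> n) * (pochhammer (- of_nat (n - i)) m
             * pochhammer (c' + of_nat m) m / (fact m * 3 ^ m)
             * pochhammer (\<beta> + of_nat i + of_nat m) (n - i - m))"
        unfolding f_def c'_def p by (simp add: power_add)
    qed
    also have "\<dots> = W i / (3 ^ i * pochhammer \<beta> n) * (if 3 dvd (n - i) then fact (n - i) / 3 ^ (n - i)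
        * (- 1) ^ ((n - i) div 3) * (\<alpha> gchoose ((n - i) div 3)) else 0)"
      using sum_pochhammer_one_minus_cube[where c = c' and N = "n - i"] unfolding \<beta>' \<alpha>' by (simp only:)
    finally have "(\<Sum>m\<le>n - i. f i m) = \<dots>" .
    moreover have "(3::complex) ^ n = 3 ^ i * 3 ^ (n - i)" using i by (simp flip: power_add)
    ultimately show "(\<Sum>m\<le>n - i. f i m) = (if 3 dvd (n - i)
      then W i * fact (n - i) * (- 1) ^ ((n - i) div 3) * (\<alpha> gchoose ((n - i) div 3)) / (3 ^ n * pochhammer \<beta> n)
      else 0)"
      by (simp add: mult_ac)
  qed
  finally have lhs: "hyp3F2 (- of_nat n) (3 * b / 2 + of_nat l) ((1 + 3 * b) / 2)
            (3 * b + of_nat l) (b - (of_nat n - 2) / 3) (4 / 3) = \<dots>" .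
  \<comment> \<open>The base of the prefactor's denominator is \<open>- \<alpha>\<close>; reversing
    its factors gives \<open>(\<beta>)_n\<close> and the sign.\<close>
  have A: "pochhammer ((1 - 2 * of_nat n) / 3 - b) n = (- 1) ^ n * pochhammer \<beta> n"
  proof -
    have "- \<alpha> = (1 - 2 * of_nat n) / 3 - b" and "\<alpha> - of_nat n + 1 = \<beta>"
      by (simp_all add: \<alpha>_def \<beta>_def b field_simps)
    then show ?thesis using pochhammer_minus[of \<alpha> n] by (simp only:)
  qed
  show ?thesis
    unfolding lhs
    unfolding sum_distrib_left A c_def[symmetric] L_def[symmetric]
  \<comment> \<open>One sum runs to \<open>n\<close>, the other to \<open>l\<close>. For
    \<open>i > n\<close> the factor \<open>(-n)_i\<close> is zero, whatever
    \<open>shifted_fact\<close> gives at a negative index; for \<open>i > l\<close> the binomial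
    coefficient of \<open>l\<close> over \<open>i\<close> is zero.\<close>
  proof (rule sum.mono_neutral_cong)
    fix i assume "i \<in> {0..l} - {..n}"
    then have "pochhammer (- of_nat n) i = (0::complex)"
      by (simp add: pochhammer_of_nat_eq_0_lemma)
    then show "1 / 3 ^ n * (pochhammer (c + of_nat n) n / ((- 1) ^ n * pochhammer \<beta> n)) *
     ((c - 1 + 2 * of_nat i) / (c - 1) *
        (pochhammer (- of_nat l) i * pochhammer (- of_nat n) i * pochhammer (c - 1) i
          / (pochhammer 1 i * pochhammer (c + of_nat n) i * pochhammer L i)) *
        (shifted_fact (1 / 3) ((int n - int i) div 3) * shifted_fact (2 / 3) ((int n - int i) div 3)
          / (shifted_fact ((2 - 2 * of_nat n - c) / 3) ((int n - int i) div 3)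
             * shifted_fact ((3 - 2 * of_nat n - c) / 3) ((int n - int i) div 3))) *
        chi3 (int n - int i)) = 0"
      by simp
  next
    fix i assume "i \<in> {..n} - {0..l}"
    then have "(of_nat l :: complex) gchoose i = 0"
      by (simp flip: binomial_gbinomial)
    then show "(if 3 dvd (n - i)
      then W i * fact (n - i) * (- 1) ^ ((n - i) div 3) * (\<alpha> gchoose ((n - i) div 3)) / (3 ^ n * pochhammer \<beta> n)
      else 0) = 0"
      by (simp add: W_def)
  next
    fix i assume "i \<in> {..n} \<inter> {0..l}"
    then have i: "i \<le> n" "i \<le> l" by auto
    have dvd: "(3 dvd (n - i)) = (3 dvd (int n - int i))"
      using i by (metis int_dvd_int_iff of_nat_diff of_nat_numeral)
    show "(if 3 dvd (n - i)
      then W i * fact (n - i) * (- 1) ^ ((n - i) div 3) * (\<alpha> gchoose ((n - i) div 3)) / (3 ^ n * pochhammer \<beta> n)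
      else 0) = 1 / 3 ^ n * (pochhammer (c + of_nat n) n / ((- 1) ^ n * pochhammer \<beta> n)) *
     ((c - 1 + 2 * of_nat i) / (c - 1) *
        (pochhammer (- of_nat l) i * pochhammer (- of_nat n) i * pochhammer (c - 1) i
          / (pochhammer 1 i * pochhammer (c + of_nat n) i * pochhammer L i)) *
        (shifted_fact (1 / 3) ((int n - int i) div 3) * shifted_fact (2 / 3) ((int n - int i) div 3)
          / (shifted_fact ((2 - 2 * of_nat n - c) / 3) ((int n - int i) div 3)
             * shifted_fact ((3 - 2 * of_nat n - c) / 3) ((int n - int i) div 3))) *
        chi3 (int n - int i))" (is "?S = ?T")
    proof (cases "3 dvd (n - i)")
      case False
      then show ?thesis using dvd by (simp add: chi3_def)
    next
      case True
      then obtain q where q: "n - i = 3 * q" by auto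
      then have n: "n = i + 3 * q" using i by simp
      have d: "(int n - int i) div 3 = int q" by (simp add: n)
      \<comment> \<open>Divisibility makes \<open>summand_denom\<close> available, including
        \<open>c \<noteq> 1\<close>, which permits writing the weight in \<open>W\<close> as a
        quotient.\<close>
      note nz = summand_denom[OF i(2) True[unfolded dvd], unfolded d shifted_fact_of_nat, folded c_def]
      define D where "D = pochhammer (1 / 3) q * pochhammer (2 / 3) q
             / (pochhammer ((2 - 2 * of_nat n - c) / 3) q * pochhammer ((3 - 2 * of_nat n - c) / 3) q)"
      have ev: "fact (3 * q) * (- 1) ^ q * (\<alpha> gchoose q)
          = (- 1) ^ q * pochhammer (c + of_nat n) n / pochhammer (c + of_nat n) i * D"
        unfolding \<alpha>_def D_def using nz by (intro fact_gbinomial_eq_pochhammer_quotient[OF n]) auto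
      have W: "W i = (- 1) ^ i * ((c - 1 + 2 * of_nat i) / (c - 1) * pochhammer (c - 1) i
          * pochhammer (- of_nat l) i * pochhammer (- of_nat n) i / (pochhammer 1 i * pochhammer L i))"
        using nz unfolding W_def by (simp add: well_poised_weight_eq gbinomial_pochhammer pochhammer_fact mult_ac)
      \<comment> \<open>The sign \<open>(- 1) ^ i\<close> comes from turning
        \<open>of_nat l gchoose i\<close> into \<open>(-l)_i\<close>, and \<open>(- 1) ^ q\<close>
        from \<open>ev\<close>. As \<open>n = i + 3 q\<close>, they combine to the sign found in
        \<open>A\<close>.\<close>
      have sgn: "(- 1) ^ i * (- 1) ^ q = (1 / (- 1) ^ n :: complex)"
        by (cases "even i"; cases "even q") (simp_all add: n power_add power_mult)
      have "?S = W i * (fact (3 * q) * (- 1) ^ q * (\<alpha> gchoose q)) / (3 ^ n * pochhammer \<beta> n)"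
        using True by (simp add: q mult_ac)
      also have "\<dots> = ((- 1) ^ i * (- 1) ^ q) * ((c - 1 + 2 * of_nat i) / (c - 1) * pochhammer (c - 1) i
          * pochhammer (- of_nat l) i * pochhammer (- of_nat n) i / (pochhammer 1 i * pochhammer L i))
          * pochhammer (c + of_nat n) n / pochhammer (c + of_nat n) i * D / (3 ^ n * pochhammer \<beta> n)"
        unfolding ev W by (simp add: mult_ac)
      also have "\<dots> = ?T"
        using True unfolding sgn d shifted_fact_of_nat D_def[symmetric] dvd
        by (simp add: chi3_def mult_ac)
      finally show ?thesis .
    qed
  qed auto
qed

end
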